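(* Consider the following statements on a $d$-clutter $\mathcal{C}$ on $[n]$. (i) No MS-induced subclutter of $\mathcal{C}$ is a non-complete C$_2$-cycle. (ii) $\mathcal{C}$ is chordal. (iii) No vertex induced subclutter of $\mathcal{C}$ is a non-complete C$_3$-cycle. Then (i) implies (ii), and (ii) implies (iii).
   Context: Let $[n]=\{1,\ldots,n\}$ and let $d\ge 0$ be an integer. A $d$-clutter on $[n]$ is a (possibly empty) family $\mathcal{C}$ of $(d+1)$-subsets of $[n]$, called circuits; a subclutter is a subfamily. A maximal subcircuit (MS) of $\mathcal{C}$ is a $d$-subset of $[n]$ contained in some circuit; $\mathcal{MS}(\mathcal{C})$ is the set of them. For $e\subseteq[n]$, $\mathcal{C}-e$ is the family of circuits that do not contain $e$. A set $L\subseteq[n]$ is a clique in $\mathcal{C}$ if every $(d+1)$-subset of $L$ is in $\mathcal{C}$. For an MS $e$, $\mathrm{N}[e]=e\cup\{v\in[n]: e\cup\{v\}\in\mathcal{C}\}$; $e$ is simplicial if $\mathrm{N}[e]$ is a clique; $\mathcal{SMS}(\mathcal{C})$ is the set of simplicial maximal subcircuits. $\mathcal{C}$ is chordal if it is empty or there is a sequence $e_1,\ldots,e_t$ such that $e_i\in\mathcal{SMS}(\mathcal{C}-e_1-\cdots-e_{i-1})$ for each $i$ and $\mathcal{C}-e_1-\cdots-e_t=\emptyset$. The vertices of a nonempty clutter are the elements of the union of its circuits; the clutter is complete if its vertex set is a clique (all $(d+1)$-subsets of the vertex set are circuits). For a set $A$ of vertices, the subclutter of $\mathcal{C}$ induced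 by $A$ (a vertex induced subclutter) is $\{F\in\mathcal{C}: F\subseteq A\}$. For $M\subseteq\mathcal{MS}(\mathcal{C})$, the subclutter of $\mathcal{C}$ induced by $M$ (an MS-induced subclutter) is $\{F\in\mathcal{C}: \text{every } d\text{-subset of } F \text{ is in } M\}$. A nonempty $d$-clutter $\mathcal{D}$ is a C$_2$-cycle (respectively, C$_3$-cycle) if either it is a complete clutter on exactly $d+2$ vertices, or $\mathcal{SMS}(\mathcal{D})=\emptyset$ and $\mathcal{SMS}(\mathcal{D}')\ne\emptyset$ for each nonempty $\mathcal{D}'\subsetneq\mathcal{D}$ that is a subclutter of $\mathcal{D}$ induced by a subset of $\mathcal{MS}(\mathcal{D})$ (respectively, by a set of vertices of $\mathcal{D}$). *)

theory Defs
  imports "HOL-Library.Ramsey"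
begin

(* nsets A k (from Ramsey) is the family of finite subsets of A with exactly k elements. *)

definition clutter :: "nat \<Rightarrow> nat \<Rightarrow> nat set set \<Rightarrow> bool" where
  "clutter n d C \<longleftrightarrow> C \<subseteq> nsets {1..n} (d + 1)"

definition vertices :: "nat set set \<Rightarrow> nat set" where
  "vertices C = \<Union>C"

definition MS :: "nat \<Rightarrow> nat \<Rightarrow> nat set set \<Rightarrow> nat set set" where
  "MS n d C = {e \<in> nsets {1..n} d. \<exists>F\<in>C. e \<subseteq> F}"

definition deletion :: "nat set set \<Rightarrow> nat set \<Rightarrow> nat set set" where
  "deletion C e = {F \<in> C. \<not> e \<subseteq> F}"

definition is_clique :: "nat \<Rightarrow> nat \<Rightarrow> nat set set \<Rightarrow> nat set \<Rightarrow> bool" where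
  "is_clique n d C L \<longleftrightarrow> L \<subseteq> {1..n} \<and> nsets L (d + 1) \<subseteq> C"

definition closed_nbhd :: "nat \<Rightarrow> nat set set \<Rightarrow> nat set \<Rightarrow> nat set" where
  "closed_nbhd n C e = e \<union> {v \<in> {1..n}. e \<union> {v} \<in> C}"

definition SMS :: "nat \<Rightarrow> nat \<Rightarrow> nat set set \<Rightarrow> nat set set" where
  "SMS n d C = {e \<in> MS n d C. is_clique n d C (closed_nbhd n C e)}"

definition chordal :: "nat \<Rightarrow> nat \<Rightarrow> nat set set \<Rightarrow> bool" where
  "chordal n d C \<longleftrightarrow> C = {} \<or>
     (\<exists>es. (\<forall>i < length es. es ! i \<in> SMS n d (foldl deletion C (take i es)))
         \<and> foldl deletion C es = {})"

definition complete_clutter :: "nat \<Rightarrow> nat \<Rightarrow> nat set set \<Rightarrow> bool" where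
  "complete_clutter n d C \<longleftrightarrow> C \<noteq> {} \<and> is_clique n d C (vertices C)"

definition vertex_induced :: "nat set set \<Rightarrow> nat set \<Rightarrow> nat set set" where
  "vertex_induced C A = {F \<in> C. F \<subseteq> A}"

definition MS_induced :: "nat \<Rightarrow> nat set set \<Rightarrow> nat set set \<Rightarrow> nat set set" where
  "MS_induced d C M = {F \<in> C. nsets F d \<subseteq> M}"

definition C2_cycle :: "nat \<Rightarrow> nat \<Rightarrow> nat set set \<Rightarrow> bool" where
  "C2_cycle n d D \<longleftrightarrow> clutter n d D \<and> D \<noteq> {} \<and>
     ((complete_clutter n d D \<and> card (vertices D) = d + 2) \<or>
      (SMS n d D = {} \<and>
       (\<forall>M \<subseteq> MS n d D. MS_induced d D M \<noteq> {} \<and> MS_induced d D M \<subset> D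
          \<longrightarrow> SMS n d (MS_induced d D M) \<noteq> {})))"

definition C3_cycle :: "nat \<Rightarrow> nat \<Rightarrow> nat set set \<Rightarrow> bool" where
  "C3_cycle n d D \<longleftrightarrow> clutter n d D \<and> D \<noteq> {} \<and>
     ((complete_clutter n d D \<and> card (vertices D) = d + 2) \<or>
      (SMS n d D = {} \<and>
       (\<forall>A \<subseteq> vertices D. vertex_induced D A \<noteq> {} \<and> vertex_induced D A \<subset> D
          \<longrightarrow> SMS n d (vertex_induced D A) \<noteq> {})))"

end

theory Submission
  imports Defs
begin

text \<open>
  For the first implication, deleting a maximal subcircuit produces an MS-induced subclutter. Hence,
  if greedy deletion of simplicial maximal subcircuits gets stuck, some nonempty MS-induced subclutter
  has no simplicial maximal subcircuit, and a smallest one is a C2-cycle; it is not complete, since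
  every maximal subcircuit of a complete clutter is simplicial.
  For the second, let \<open>D\<close> be a nonempty induced subclutter of a chordal clutter, and consider the first
  \<open>e\<close> of the elimination sequence that lies in a circuit of \<open>D\<close>. No circuit of \<open>D\<close> has been removed
  before, so \<open>e\<close>, being simplicial in the current clutter, is simplicial in \<open>D\<close>.
\<close>

lemma clutter_subset: "clutter n d C \<Longrightarrow> D \<subseteq> C \<Longrightarrow> clutter n d D"
  by (auto simp: clutter_def)

lemma clutter_deletion: "clutter n d C \<Longrightarrow> clutter n d (deletion C e)"
  by (rule clutter_subset) (auto simp: deletion_def)

lemma finite_clutter: "clutter n d C \<Longrightarrow> finite C"
  unfolding clutter_def
  by (erule finite_subset) (simp add: finite_imp_finite_nsets)

lemma nsets_circuit_subset_MS:
  assumes "clutter n d C" "F \<in> C"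
  shows "nsets F d \<subseteq> MS n d C"
proof -
  have "F \<subseteq> {1..n}" using assms by (auto simp: clutter_def nsets_def)
  then show ?thesis using assms(2) unfolding MS_def nsets_def by blast
qed

lemma MS_induced_subset: "MS_induced d C M \<subseteq> C"
  by (auto simp: MS_induced_def)

lemma MS_induced_MS: "clutter n d C \<Longrightarrow> MS_induced d C (MS n d C) = C"
  using nsets_circuit_subset_MS unfolding MS_induced_def by blast

lemma MS_induced_Int: "MS_induced d (MS_induced d C M) M' = MS_induced d C (M \<inter> M')"
  by (auto simp: MS_induced_def)

text \<open>Since \<open>e\<close> has exactly \<open>d\<close> elements, a circuit contains
  \<open>e\<close> iff \<open>e\<close> is one of its \<open>d\<close>-subsets, and all of these are
  maximal subcircuits.\<close>

lemma deletion_eq_MS_induced: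
  assumes "clutter n d C" "e \<in> MS n d C"
  shows "deletion C e = MS_induced d C (MS n d C - {e})"
proof -
  have "nsets F d \<subseteq> MS n d C - {e} \<longleftrightarrow> \<not> e \<subseteq> F" if "F \<in> C" for F
  proof -
    have "e \<in> nsets F d \<longleftrightarrow> e \<subseteq> F" using assms(2) by (auto simp: MS_def nsets_def)
    then show ?thesis using nsets_circuit_subset_MS[OF assms(1) that] by blast
  qed
  then show ?thesis unfolding deletion_def MS_induced_def by blast
qed

lemma is_clique_mono: "is_clique n d C L \<Longrightarrow> L' \<subseteq> L \<Longrightarrow> is_clique n d C L'"
  using nsets_mono[of L' L "d + 1"] unfolding is_clique_def by blast

text \<open>Any \<open>d\<close>-subset of a circuit will do: its closed neighbourhood is covered by
  circuits, so it lies in the vertex set, which is a clique.\<close>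

lemma complete_clutter_SMS:
  assumes "clutter n d C" "complete_clutter n d C"
  shows "SMS n d C \<noteq> {}"
proof -
  obtain F where F: "F \<in> C" using assms(2) by (auto simp: complete_clutter_def)
  then have "finite F" "card F = d + 1" using assms(1) by (auto simp: clutter_def nsets_def)
  then obtain e where "e \<subseteq> F" "card e = d" "finite e"
    by (metis le_add1 obtain_subset_with_card_n)
  then have e: "e \<in> MS n d C"
    using F nsets_circuit_subset_MS[OF assms(1) F] by (auto simp: nsets_def)
  then have "closed_nbhd n C e \<subseteq> vertices C"
    by (auto simp: closed_nbhd_def vertices_def MS_def)
  then show ?thesis
    using e assms(2) is_clique_mono unfolding SMS_def complete_clutter_def by blast
qed

lemma chordal_deletion:
  assumes "e \<in> SMS n d C" "chordal n d (deletion C e)"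
  shows "chordal n d C"
proof -
  obtain es where es: "\<forall>i < length es. es ! i \<in> SMS n d (foldl deletion (deletion C e) (take i es))"
    "foldl deletion (deletion C e) es = {}"
  \<comment> \<open>For an empty clutter \<open>chordal\<close> provides no sequence, so the empty
    list is supplied by hand.\<close>
  proof (cases "deletion C e = {}")
    case True
    then show ?thesis using that[of "[]"] by simp
  next
    case False
    then show ?thesis using that assms(2) by (auto simp: chordal_def)
  qed
  have "\<forall>i < length (e # es). (e # es) ! i \<in> SMS n d (foldl deletion C (take i (e # es)))"
    using assms(1) es(1) by (simp add: All_less_Suc2)
  moreover have "foldl deletion C (e # es) = {}" using es(2) by simp
  ultimately show ?thesis unfolding chordal_def by blast
qed

text \<open>The hypothesis passes from \<open>C\<close> to \<open>deletion C e\<close>, whose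
  MS-induced subclutters are MS-induced in \<open>C\<close> as well; this drives the induction on
  the number of circuits.\<close>

lemma chordalI_MS_induced:
  assumes "clutter n d C"
    and "\<And>M. M \<subseteq> MS n d C \<Longrightarrow> MS_induced d C M \<noteq> {} \<Longrightarrow> SMS n d (MS_induced d C M) \<noteq> {}"
  shows "chordal n d C"
  using assms
proof (induction "card C" arbitrary: C rule: less_induct)
  case less
  show ?case
  proof (cases "C = {}")
    case True
    then show ?thesis by (simp add: chordal_def)
  next
    case False
    \<comment> \<open>\<open>C\<close> is induced by the set of all its maximal subcircuits, so the
      hypothesis applies to \<open>C\<close> itself.\<close>
    then obtain e where e: "e \<in> SMS n d C"
      using less.prems(2)[of "MS n d C"] MS_induced_MS[OF less.prems(1)] by auto
    then have eMS: "e \<in> MS n d C" by (simp add: SMS_def)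
    then have "deletion C e \<subset> C" by (auto simp: MS_def deletion_def)
    then have "card (deletion C e) < card C"
      using finite_clutter[OF less.prems(1)] by (simp add: psubset_card_mono)
    moreover have "SMS n d (MS_induced d (deletion C e) M) \<noteq> {}"
      if "MS_induced d (deletion C e) M \<noteq> {}" for M
      using less.prems(2)[of "(MS n d C - {e}) \<inter> M"] that
      by (auto simp: deletion_eq_MS_induced[OF less.prems(1) eMS] MS_induced_Int)
    ultimately have "chordal n d (deletion C e)"
      using less.hyps clutter_deletion[OF less.prems(1)] by blast
    then show ?thesis using e chordal_deletion by blast
  qed
qed

lemma not_chordal_obtains_C2_cycle:
  assumes C: "clutter n d C" and "\<not> chordal n d C"
  obtains M where "M \<subseteq> MS n d C" "C2_cycle n d (MS_induced d C M)"
    "\<not> complete_clutter n d (MS_induced d C M)"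
proof -
  define P where "P M \<longleftrightarrow> M \<subseteq> MS n d C \<and> MS_induced d C M \<noteq> {} \<and> SMS n d (MS_induced d C M) = {}"
    for M
  have "\<exists>M. P M" using chordalI_MS_induced[OF C] assms(2) unfolding P_def by blast
  \<comment> \<open>What is minimised is the number of circuits induced, not the size of
    \<open>M\<close>: different sets may induce the same subclutter.\<close>
  then obtain M where M: "P M"
    and least: "\<And>M'. P M' \<Longrightarrow> card (MS_induced d C M) \<le> card (MS_induced d C M')"
    using ex_has_least_nat[of P _ "\<lambda>M. card (MS_induced d C M)"] by blast
  let ?D = "MS_induced d C M"
  have D: "clutter n d ?D" using C MS_induced_subset by (rule clutter_subset)
  have "SMS n d (MS_induced d ?D M') \<noteq> {}"
    if "MS_induced d ?D M' \<noteq> {}" "MS_induced d ?D M' \<subset> ?D" for M'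
  proof
    assume "SMS n d (MS_induced d ?D M') = {}"
    then have "P (M \<inter> M')" using M that(1) by (auto simp: P_def MS_induced_Int)
    then have "card ?D \<le> card (MS_induced d ?D M')" using least by (simp add: MS_induced_Int)
    moreover have "card (MS_induced d ?D M') < card ?D"
      using that(2) finite_clutter[OF D] by (simp add: psubset_card_mono)
    ultimately show False by simp
  qed
  then have "C2_cycle n d ?D" using M D by (auto simp: C2_cycle_def P_def)
  moreover have "\<not> complete_clutter n d ?D" using complete_clutter_SMS[OF D] M by (auto simp: P_def)
  ultimately show ?thesis using that M by (auto simp: P_def)
qed

text \<open>The circuit \<open>F\<close> keeps \<open>e\<close> a maximal subcircuit and puts it
  inside \<open>A\<close>. The new neighbourhood then lies in both \<open>A\<close> and the old one,
  so its \<open>(d + 1)\<close>-subsets are circuits of \<open>C\<close> within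
  \<open>A\<close>.\<close>

lemma SMS_vertex_induced:
  assumes "e \<in> SMS n d C" "F \<in> vertex_induced C A" "e \<subseteq> F"
  shows "e \<in> SMS n d (vertex_induced C A)"
proof -
  let ?D = "vertex_induced C A"
  have "e \<in> MS n d ?D" using assms by (auto simp: SMS_def MS_def)
  moreover have "closed_nbhd n ?D e \<subseteq> A"
    using assms(2,3) by (auto simp: closed_nbhd_def vertex_induced_def)
  moreover have "closed_nbhd n ?D e \<subseteq> closed_nbhd n C e"
    by (auto simp: closed_nbhd_def vertex_induced_def)
  then have "is_clique n d C (closed_nbhd n ?D e)"
    using assms(1) is_clique_mono unfolding SMS_def by blast
  ultimately show ?thesis
    by (fastforce simp: SMS_def is_clique_def vertex_induced_def nsets_def)
qed

lemma chordal_vertex_induced_SMS: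
  assumes "chordal n d C" "vertex_induced C A \<noteq> {}"
  shows "SMS n d (vertex_induced C A) \<noteq> {}"
proof -
  \<comment> \<open>Stated for every clutter with an elimination sequence, because the induction on
    the sequence replaces \<open>C\<close> by \<open>deletion C e\<close> while \<open>A\<close>
    stays fixed.\<close>
  have *: "SMS n d (vertex_induced C A) \<noteq> {}"
    if "\<forall>i < length es. es ! i \<in> SMS n d (foldl deletion C (take i es))"
      "foldl deletion C es = {}" "vertex_induced C A \<noteq> {}" for es C
    using that
  proof (induction es arbitrary: C)
    case Nil
    then show ?case by (simp add: vertex_induced_def)
  next
    case (Cons e es)
    have e: "e \<in> SMS n d C"
      and es: "\<forall>i < length es. es ! i \<in> SMS n d (foldl deletion (deletion C e) (take i es))"
      using Cons.prems(1) by (simp_all add: All_less_Suc2)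
    show ?case
    proof (cases "\<exists>F \<in> vertex_induced C A. e \<subseteq> F")
      case True
      then show ?thesis using SMS_vertex_induced[OF e] by blast
    next
      case False
      then have "vertex_induced (deletion C e) A = vertex_induced C A"
        by (auto simp: vertex_induced_def deletion_def)
      then show ?thesis using Cons.IH[OF es] Cons.prems(2,3) by simp
    qed
  qed
  have "C \<noteq> {}" using assms(2) by (auto simp: vertex_induced_def)
  then show ?thesis using assms * unfolding chordal_def by blast
qed

theorem proposition4p9:
  fixes n d :: nat and C :: "nat set set"
  assumes "clutter n d C"
  shows "((\<forall>M \<subseteq> MS n d C. \<not> (C2_cycle n d (MS_induced d C M)
              \<and> \<not> complete_clutter n d (MS_induced d C M)))
            \<longrightarrow> chordal n d C)
       \<and> (chordal n d C \<longrightarrow>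
           (\<forall>A \<subseteq> vertices C. \<not> (C3_cycle n d (vertex_induced C A)
              \<and> \<not> complete_clutter n d (vertex_induced C A))))"
proof (intro conjI impI)
  assume "\<forall>M \<subseteq> MS n d C. \<not> (C2_cycle n d (MS_induced d C M)
              \<and> \<not> complete_clutter n d (MS_induced d C M))"
  then show "chordal n d C" using not_chordal_obtains_C2_cycle[OF assms] by blast
next
  assume "chordal n d C"
  have "complete_clutter n d (vertex_induced C A)" if "C3_cycle n d (vertex_induced C A)" for A
  proof -
    have "SMS n d (vertex_induced C A) \<noteq> {}"
      using \<open>chordal n d C\<close> that by (intro chordal_vertex_induced_SMS) (auto simp only: C3_cycle_def)
    \<comment> \<open>Of the two alternatives for a C3-cycle, only completeness is left.\<close>
    then show ?thesis using that unfolding C3_cycle_def by argo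
  qed
  then show "\<forall>A \<subseteq> vertices C. \<not> (C3_cycle n d (vertex_induced C A)
              \<and> \<not> complete_clutter n d (vertex_induced C A))"
    by blast
qed

end
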